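(* Let $G=C_{2n}$ be the even cycle on $2n$ vertices $1,\dots,2n$, where $n\ge2$ is even, and let $\pi=\{C_i\}_{i=1}^n$ with $C_i=\{i,i+n\}$ be the equitable vertex partition of $G$. Then $G$ exhibits perfect state transfer at time $k=\frac n2$ from the state $Q_\tau x_{C_i}$ to the state $Q_\tau x_{C_j}$, where $j\equiv i+\frac n2\pmod n$.
   Context: $C_{2n}$ is viewed as a $2$-regular directed graph (each edge gives two opposite arcs), with adjacency matrix $A$. The quotient graph $C_{2n}/\pi$ has adjacency matrix $\widetilde A=(b_{ij})$, where $b_{ij}$ is the number of neighbours in $C_j$ of any vertex of $C_i$. It is the $n$-cycle $C_n$ for $n\geq 3$; for $n=2$ it has two vertices with two parallel arcs in each direction. Shunt decompositions $A=P_1+P_2$ and $\widetilde A=\widetilde P_1+\widetilde P_2$ into permutation matrices are used, with $P_jQ=Q\widetilde P_j$ and $\widetilde P_j^2=I_n$ for $j=1,2$. Here $$Q=\widetilde Q=\frac1{\sqrt2}\begin{pmatrix} I_n \\ I_n \end{pmatrix}\in\mathbb R^{2n\times n}$$ is both the normalized characteristic matrix of $\pi$ and the normalized characteristic matrix of the partition of the $2n$ arcs of $C_{2n}/\pi$ by terminal vertex (arcs indexed by pairs (shunt index, terminal cell)), and $Q_\tau=I_2\otimes\widetilde Q\in\mathbb R^{4n\times2n}$. Let $S=\sum_{j=1}^2E_{jj}\otimes P_j$, with $E_{jj}$ the $2\times2$ diagonal matrix units. The transition operator of $G$ is $$U=S\bigl(2Q_\tau(\widetilde Q\widetilde Q^\top)Q_\tau^\top-I\bigr)\in\mathbb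 C^{4n\times4n}.$$ With $e_{C_i}$ the $i$-th standard basis vector of $\mathbb C^n$, $x_{C_i}=\widetilde Qe_{C_i}$. Perfect state transfer from a unit vector $u$ to a unit vector $v$ at time $k$ means $|\langle v,U^ku\rangle|=1$, equivalently $U^ku=\gamma v$ with $|\gamma|=1$. *)

theory Defs
  imports
    Complex_Main
    "HOL-Library.Disjoint_Sets"
    "HOL-Combinatorics.Permutations"
    "HOL-Number_Theory.Cong"
    "Jordan_Normal_Form.Matrix"
    "Jordan_Normal_Form.Conjugate"
    "Graph_Theory.Pair_Digraph"
begin

(* All index sets start at 0: the vertices 1,...,2n become 0,...,2n-1, and the cells
   C_1,...,C_n become cell n 0,...,cell n (n-1). Matrices and vectors are complex throughout. *)

section \<open>Cycles, partitions and quotients\<close>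

definition cycle_digraph :: "nat \<Rightarrow> nat pair_pre_digraph" where
  "cycle_digraph m = \<lparr> pverts = {..<m},
     parcs = {(u, v). u < m \<and> v < m \<and> (v = (u + 1) mod m \<or> u = (v + 1) mod m)} \<rparr>"

definition adjacency_mat :: "nat \<Rightarrow> nat pair_pre_digraph \<Rightarrow> complex mat" where
  "adjacency_mat m G = mat m m (\<lambda>(u, v). if (u, v) \<in> parcs G then 1 else 0)"

definition neighbours_in :: "nat pair_pre_digraph \<Rightarrow> nat set \<Rightarrow> nat \<Rightarrow> nat" where
  "neighbours_in G D u = card {v \<in> D. (u, v) \<in> parcs G}"

definition equitable_partition :: "nat pair_pre_digraph \<Rightarrow> nat \<Rightarrow> (nat \<Rightarrow> nat set) \<Rightarrow> bool" where
  "equitable_partition G m C \<longleftrightarrow>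
     (\<Union>i<m. C i) = pverts G \<and> (\<forall>i<m. C i \<noteq> {}) \<and> disjoint_family_on C {..<m} \<and>
     (\<forall>i<m. \<forall>j<m. \<exists>b. \<forall>u\<in>C i. neighbours_in G (C j) u = b)"

(* The description THE b picks the common value of the neighbour counts; it is meaningful for
   equitable partitions, see quotient_mat_index. *)
definition quotient_mat :: "nat pair_pre_digraph \<Rightarrow> nat \<Rightarrow> (nat \<Rightarrow> nat set) \<Rightarrow> complex mat" where
  "quotient_mat G m C =
     mat m m (\<lambda>(i, j). of_nat (THE b. \<forall>u\<in>C i. neighbours_in G (C j) u = b))"

definition cell :: "nat \<Rightarrow> nat \<Rightarrow> nat set" where
  "cell n i = {i, i + n}"

section \<open>Matrices\<close>

definition permutation_matrix :: "nat \<Rightarrow> complex mat \<Rightarrow> bool" where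
  "permutation_matrix m P \<longleftrightarrow>
     (\<exists>f. f permutes {..<m} \<and> P = mat m m (\<lambda>(u, v). if v = f u then 1 else 0))"

definition shunt_decomposition :: "nat \<Rightarrow> complex mat \<Rightarrow> complex mat \<Rightarrow> complex mat \<Rightarrow> bool" where
  "shunt_decomposition m A P1 P2 \<longleftrightarrow>
     permutation_matrix m P1 \<and> permutation_matrix m P2 \<and> A = P1 + P2"

definition norm_char_mat :: "nat \<Rightarrow> nat \<Rightarrow> (nat \<Rightarrow> nat set) \<Rightarrow> complex mat" where
  "norm_char_mat N m C =
     mat N m (\<lambda>(v, i). if v \<in> C i then complex_of_real (1 / sqrt (real (card (C i)))) else 0)"

definition kronecker :: "complex mat \<Rightarrow> complex mat \<Rightarrow> complex mat" (infixl "\<otimes>\<^sub>k" 72) where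
  "A \<otimes>\<^sub>k B = mat (dim_row A * dim_row B) (dim_col A * dim_col B)
     (\<lambda>(i, j). A $$ (i div dim_row B, j div dim_col B) * B $$ (i mod dim_row B, j mod dim_col B))"

definition diag_unit :: "nat \<Rightarrow> nat \<Rightarrow> complex mat" where
  "diag_unit m l = mat m m (\<lambda>(i, j). if i = l \<and> j = l then 1 else 0)"

section \<open>The walk\<close>

definition Q_vertex :: "nat \<Rightarrow> complex mat" where
  "Q_vertex n = norm_char_mat (2 * n) n (cell n)"

(* The arc of the quotient graph belonging to shunt s (s = 0, 1) with terminal cell t has
   index s * n + t, so an arc a < 2 * n terminates at a mod n. *)
definition arcs_into :: "nat \<Rightarrow> nat \<Rightarrow> nat set" where
  "arcs_into n t = {a. a < 2 * n \<and> a mod n = t}"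

definition Q_arc :: "nat \<Rightarrow> complex mat" where
  "Q_arc n = norm_char_mat (2 * n) n (arcs_into n)"

definition Q_tau :: "nat \<Rightarrow> complex mat" where
  "Q_tau n = 1\<^sub>m 2 \<otimes>\<^sub>k Q_arc n"

definition shunt_operator :: "complex mat \<Rightarrow> complex mat \<Rightarrow> complex mat" where
  "shunt_operator P1 P2 = diag_unit 2 0 \<otimes>\<^sub>k P1 + diag_unit 2 1 \<otimes>\<^sub>k P2"

definition transition_operator :: "nat \<Rightarrow> complex mat \<Rightarrow> complex mat \<Rightarrow> complex mat" where
  "transition_operator n P1 P2 =
     shunt_operator P1 P2 *
       (2 \<cdot>\<^sub>m (Q_tau n * (Q_arc n * (Q_arc n)\<^sup>T) * (Q_tau n)\<^sup>T) - 1\<^sub>m (4 * n))"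

definition x_state :: "nat \<Rightarrow> nat \<Rightarrow> complex vec" where
  "x_state n i = Q_arc n *\<^sub>v unit_vec n i"

definition perfect_state_transfer ::
  "complex mat \<Rightarrow> nat \<Rightarrow> complex vec \<Rightarrow> complex vec \<Rightarrow> bool" where
  "perfect_state_transfer U k u v \<longleftrightarrow>
     u \<in> carrier_vec (dim_row U) \<and> v \<in> carrier_vec (dim_row U) \<and>
     u \<bullet>c u = 1 \<and> v \<bullet>c v = 1 \<and> cmod (((U ^\<^sub>m k) *\<^sub>v u) \<bullet>c v) = 1"

section \<open>Consistency checks\<close>

lemma quotient_mat_index:
  assumes "equitable_partition G m C" "i < m" "j < m" "u \<in> C i"
  shows "quotient_mat G m C $$ (i, j) = of_nat (neighbours_in G (C j) u)"
proof -
  obtain b where b: "\<forall>u\<in>C i. neighbours_in G (C j) u = b"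
    using assms(1-3) unfolding equitable_partition_def by meson
  then have "neighbours_in G (C j) u = b" using assms(4) by simp
  moreover have "(THE b. \<forall>u\<in>C i. neighbours_in G (C j) u = b) = b"
    using b assms(4) by (intro the_equality) auto
  ultimately have "(THE b. \<forall>u\<in>C i. neighbours_in G (C j) u = b) = neighbours_in G (C j) u"
    by simp
  then show ?thesis using assms by (simp add: quotient_mat_def)
qed

lemma Suc_mod_if: "u < m \<Longrightarrow> (u + 1) mod m = (if u + 1 = m then 0 else u + 1)" for u m :: nat
  by auto

lemma neighbours_in_cell:
  assumes "2 \<le> n" "i < n" "j < n" "u \<in> cell n i"
  shows "neighbours_in (cycle_digraph (2 * n)) (cell n j) u =
    (if j = (i + 1) mod n then 1 else 0) + (if i = (j + 1) mod n then 1 else 0)"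
proof -
  let ?E = "\<lambda>v. (u, v) \<in> parcs (cycle_digraph (2 * n))"
  have E: "?E v \<longleftrightarrow> (if u + 1 = 2 * n then v = 0 else v = u + 1) \<or>
      (if v + 1 = 2 * n then u = 0 else u = v + 1)" if "v < 2 * n" for v
    using assms that by (auto simp: cycle_digraph_def cell_def)
  have "{v \<in> cell n j. ?E v} = (if ?E j then {j} else {}) \<union> (if ?E (j + n) then {j + n} else {})"
    by (auto simp: cell_def)
  then have "neighbours_in (cycle_digraph (2 * n)) (cell n j) u =
      (if ?E j then 1 else 0) + (if ?E (j + n) then 1 else 0)"
    using assms by (auto simp: neighbours_in_def)
  also have "\<dots> = (if j = (i + 1) mod n then 1 else 0) + (if i = (j + 1) mod n then 1 else 0)"
    unfolding Suc_mod_if[OF assms(2)] Suc_mod_if[OF assms(3)]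
  proof (cases "u = i")
    case True
    have "?E j \<longleftrightarrow> j = i + 1 \<or> i = j + 1" "?E (j + n) \<longleftrightarrow> i + 1 = n \<and> j = 0 \<or> j + 1 = n \<and> i = 0"
      using True assms by (subst E; force split: if_splits)+
    then show "(if ?E j then 1 else 0) + (if ?E (j + n) then 1 else 0) =
        (if j = (if i + 1 = n then 0 else i + 1) then 1 else 0) +
        (if i = (if j + 1 = n then 0 else j + 1) then 1 else (0 :: nat))"
      using assms by (cases "i + 1 = n"; cases "j + 1 = n"; simp; linarith)
  next
    case False
    then have "u = i + n" using assms by (simp add: cell_def)
    then have "?E (j + n) \<longleftrightarrow> j = i + 1 \<or> i = j + 1" "?E j \<longleftrightarrow> i + 1 = n \<and> j = 0 \<or> j + 1 = n \<and> i = 0"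
      using assms by (subst E; force split: if_splits)+
    then show "(if ?E j then 1 else 0) + (if ?E (j + n) then 1 else 0) =
        (if j = (if i + 1 = n then 0 else i + 1) then 1 else 0) +
        (if i = (if j + 1 = n then 0 else j + 1) then 1 else (0 :: nat))"
      using assms by (cases "i + 1 = n"; cases "j + 1 = n"; simp; linarith)
  qed
  finally show ?thesis .
qed

lemma equitable_cell:
  assumes "2 \<le> n"
  shows "equitable_partition (cycle_digraph (2 * n)) n (cell n)"
proof -
  have "v \<in> cell n (v mod n)" if "v < 2 * n" for v
    using that assms by (cases "v < n") (auto simp: cell_def mod_if)
  then have "(\<Union>i<n. cell n i) = {..<2 * n}"
    using assms by (auto simp: cell_def) (metis lessThan_iff mod_less_divisor less_le_trans pos2)
  moreover have "disjoint_family_on (cell n) {..<n}"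
    by (auto simp: disjoint_family_on_def cell_def)
  ultimately show ?thesis
    using neighbours_in_cell[OF assms]
    by (auto simp: equitable_partition_def cycle_digraph_def[of "2 * n"] cell_def[of n])
qed

(* For n >= 3 at most one summand is nonzero; for n = 2 both are 1 off the diagonal. *)
lemma quotient_mat_cell:
  assumes "2 \<le> n"
  shows "quotient_mat (cycle_digraph (2 * n)) n (cell n) =
    mat n n (\<lambda>(i, j). (if j = (i + 1) mod n then 1 else 0) + (if i = (j + 1) mod n then 1 else 0))"
proof (rule eq_matI)
  let ?B = "mat n n (\<lambda>(i, j). (if j = (i + 1) mod n then 1 else 0) +
    (if i = (j + 1) mod n then 1 else 0)) :: complex mat"
  fix i j assume "i < dim_row ?B" "j < dim_col ?B"
  then have ij: "i < n" "j < n" by simp_all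
  have i: "i \<in> cell n i" by (simp add: cell_def)
  show "quotient_mat (cycle_digraph (2 * n)) n (cell n) $$ (i, j) = ?B $$ (i, j)"
    unfolding quotient_mat_index[OF equitable_cell[OF assms] ij i] neighbours_in_cell[OF assms ij i]
    using ij by simp
qed (simp_all add: quotient_mat_def)

lemma Q_entries:
  assumes "v < 2 * n" "i < n"
  shows "Q_vertex n $$ (v, i) = (if v mod n = i then complex_of_real (1 / sqrt 2) else 0)"
    and "Q_arc n $$ (v, i) = (if v mod n = i then complex_of_real (1 / sqrt 2) else 0)"
proof -
  have mod: "v' mod n = i \<longleftrightarrow> v' = i \<or> v' = i + n" if "v' < 2 * n" for v'
    using assms that by (cases "v' < n") (auto simp: mod_if)
  then have arcs: "arcs_into n i = cell n i"
    using assms by (auto simp: arcs_into_def cell_def)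
  have card: "card (cell n i) = 2"
    using assms by (simp add: cell_def)
  show "Q_vertex n $$ (v, i) = (if v mod n = i then complex_of_real (1 / sqrt 2) else 0)"
    using assms card mod[of v] by (simp add: Q_vertex_def norm_char_mat_def cell_def)
  show "Q_arc n $$ (v, i) = (if v mod n = i then complex_of_real (1 / sqrt 2) else 0)"
    using assms card mod[of v] by (simp add: Q_arc_def norm_char_mat_def arcs cell_def)
qed

lemma Q_explicit:
  "Q_vertex n = complex_of_real (1 / sqrt 2) \<cdot>\<^sub>m (1\<^sub>m n @\<^sub>r 1\<^sub>m n)"
  "Q_arc n = Q_vertex n"
proof -
  have dim: "dim_row (Q_vertex n) = 2 * n" "dim_col (Q_vertex n) = n"
    "dim_row (Q_arc n) = 2 * n" "dim_col (Q_arc n) = n"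
    by (simp_all add: Q_vertex_def Q_arc_def norm_char_mat_def)
  show "Q_arc n = Q_vertex n"
    by (rule eq_matI) (auto simp: dim Q_entries)
  show "Q_vertex n = complex_of_real (1 / sqrt 2) \<cdot>\<^sub>m (1\<^sub>m n @\<^sub>r 1\<^sub>m n)"
  proof (rule eq_matI)
    fix v i
    assume "v < dim_row (complex_of_real (1 / sqrt 2) \<cdot>\<^sub>m (1\<^sub>m n @\<^sub>r 1\<^sub>m n))"
      and "i < dim_col (complex_of_real (1 / sqrt 2) \<cdot>\<^sub>m (1\<^sub>m n @\<^sub>r 1\<^sub>m n))"
    then have "v < 2 * n" "i < n" by (simp_all add: append_rows_def)
    then show "Q_vertex n $$ (v, i) =
        (complex_of_real (1 / sqrt 2) \<cdot>\<^sub>m (1\<^sub>m n @\<^sub>r 1\<^sub>m n)) $$ (v, i)"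
      by (cases "v < n") (auto simp: Q_entries append_rows_def mod_if)
  qed (simp_all add: dim append_rows_def)
qed

(* The two perfect matchings of a cycle of even length. *)
definition matching :: "nat \<Rightarrow> nat \<Rightarrow> nat \<Rightarrow> nat" where
  "matching m s u = (if m \<le> u then u else if even (u + s) then (u + 1) mod m
     else if u = 0 then m - 1 else u - 1)"

definition matching_mat :: "nat \<Rightarrow> nat \<Rightarrow> complex mat" where
  "matching_mat m s = mat m m (\<lambda>(u, v). if v = matching m s u then 1 else 0)"

lemma matching_less: "u < m \<Longrightarrow> matching m s u < m"
  by (auto simp: matching_def)

lemma matching_matching: "even m \<Longrightarrow> matching m s (matching m s u) = u"
  by (cases "u + 1 = m") (auto simp: matching_def)

lemma matching_mat_permutation:
  assumes "even m"
  shows "permutation_matrix m (matching_mat m s)"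
proof -
  have "matching m s u = u" if "u \<notin> {..<m}" for u
    using that by (simp add: matching_def)
  moreover have "\<exists>!v. matching m s v = u" for u
    using matching_matching[OF assms] by metis
  ultimately have "matching m s permutes {..<m}"
    unfolding permutes_def by blast
  then show ?thesis
    by (auto simp: permutation_matrix_def matching_mat_def)
qed

lemma matching_mat_mult:
  assumes "B \<in> carrier_mat m k"
  shows "matching_mat m s * B = mat m k (\<lambda>(u, j). B $$ (matching m s u, j))"
proof (rule eq_matI)
  fix u j assume "u < dim_row (mat m k (\<lambda>(u, j). B $$ (matching m s u, j)))"
    "j < dim_col (mat m k (\<lambda>(u, j). B $$ (matching m s u, j)))"
  then have uj: "u < m" "j < k" by simp_all
  have "(matching_mat m s * B) $$ (u, j) =
      (\<Sum>v<m. (if v = matching m s u then 1 else 0) * B $$ (v, j))"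
    using assms uj by (simp add: matching_mat_def scalar_prod_def atLeast0LessThan)
  also have "\<dots> = (\<Sum>v<m. if v = matching m s u then B $$ (v, j) else 0)"
    by (rule sum.cong) auto
  also have "\<dots> = B $$ (matching m s u, j)"
    using matching_less[OF uj(1)] by simp
  finally show "(matching_mat m s * B) $$ (u, j) = mat m k (\<lambda>(u, j). B $$ (matching m s u, j)) $$ (u, j)"
    using uj by simp
qed (use assms in \<open>simp_all add: matching_mat_def\<close>)

lemma matching_cycle:
  fixes u v :: nat
  assumes "u < m" "v < m"
  shows "(if v = matching m 0 u then 1 else 0) + (if v = matching m 1 u then 1 else 0) =
    (if v = (u + 1) mod m then 1 else 0) + (if u = (v + 1) mod m then 1 else (0 :: complex))"
proof -
  have "v = (if u = 0 then m - 1 else u - 1) \<longleftrightarrow> u = (v + 1) mod m"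
    using assms Suc_mod_if[OF assms(2)] by (cases "u = 0") auto
  then show ?thesis
    using assms(1) by (cases "even u") (simp_all add: matching_def)
qed

lemma matching_mod:
  assumes "even n" "0 < n" "u < 2 * n"
  shows "matching (2 * n) s u mod n = matching n s (u mod n)"
proof -
  have lt: "(2 * n \<le> u) = False" "(n \<le> u mod n) = False"
    using assms by (simp_all add: not_le)
  have ev: "even (u mod n) \<longleftrightarrow> even u"
    using assms(1) by (rule dvd_mod_iff)
  show ?thesis
  proof (cases "even (u + s)")
    case True
    then have "even (u mod n + s)"
      using ev by simp
    moreover have "(u + 1) mod (2 * n) mod n = (u mod n + 1) mod n"
      by (simp only: mod_mod_cancel[OF dvd_triv_right] mod_add_left_eq)
    ultimately show ?thesis
      using True assms by (simp only: matching_def lt if_True if_False)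
  next
    case False
    then have odd: "odd (u mod n + s)"
      using ev by simp
    have "(if u = 0 then 2 * n - 1 else u - 1) mod n = (if u mod n = 0 then n - 1 else u mod n - 1)"
    proof (cases "u < n")
      case True
      have "(2 * n - 1) mod n = (n - 1 + n) mod n" using assms by (intro arg_cong2[of _ _ _ _ "(mod)"]) auto
      also have "\<dots> = n - 1" using assms by (simp only: mod_add_self2) simp
      finally show ?thesis using True by (simp only: mod_less) (auto split: if_splits)
    next
      case False
      then obtain w where w: "u = w + n" by (metis add.commute le_Suc_ex not_less)
      show ?thesis
      proof (cases w)
        case (Suc w')
        then have "u - 1 = w' + n" "w < n" using w assms by auto
        moreover from this have "u mod n = w" using w by simp
        ultimately show ?thesis using w Suc by simp
      qed (use w assms in simp)
    qed
    then show ?thesis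
      using False odd by (simp only: matching_def lt if_False)
  qed
qed

text \<open>The hypotheses on the shunt decompositions are satisfiable for every even \<open>n \<ge> 2\<close>.\<close>

lemma shunt_decompositions_exist:
  assumes "2 \<le> n" "even n"
  shows "\<exists>P1 P2 P1' P2'.
    shunt_decomposition (2 * n) (adjacency_mat (2 * n) (cycle_digraph (2 * n))) P1 P2 \<and>
    shunt_decomposition n (quotient_mat (cycle_digraph (2 * n)) n (cell n)) P1' P2' \<and>
    P1 * Q_vertex n = Q_vertex n * P1' \<and> P2 * Q_vertex n = Q_vertex n * P2' \<and>
    P1' * P1' = 1\<^sub>m n \<and> P2' * P2' = 1\<^sub>m n"
proof -
  have "adjacency_mat (2 * n) (cycle_digraph (2 * n)) = matching_mat (2 * n) 0 + matching_mat (2 * n) 1"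
  proof (rule eq_matI)
    fix u v assume "u < dim_row (matching_mat (2 * n) 0 + matching_mat (2 * n) 1)"
      "v < dim_col (matching_mat (2 * n) 0 + matching_mat (2 * n) 1)"
    then have uv: "u < 2 * n" "v < 2 * n" by (simp_all add: matching_mat_def)
    have "\<not> (v = (u + 1) mod (2 * n) \<and> u = (v + 1) mod (2 * n))"
      unfolding Suc_mod_if[OF uv(1)] Suc_mod_if[OF uv(2)] using assms(1) by (auto split: if_splits)
    then show "adjacency_mat (2 * n) (cycle_digraph (2 * n)) $$ (u, v) =
        (matching_mat (2 * n) 0 + matching_mat (2 * n) 1) $$ (u, v)"
      using uv matching_cycle[OF uv]
      by (auto simp: adjacency_mat_def cycle_digraph_def matching_mat_def)
  qed (simp_all add: adjacency_mat_def matching_mat_def)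
  then have A: "shunt_decomposition (2 * n) (adjacency_mat (2 * n) (cycle_digraph (2 * n)))
      (matching_mat (2 * n) 0) (matching_mat (2 * n) 1)"
    by (simp add: shunt_decomposition_def matching_mat_permutation)
  have "quotient_mat (cycle_digraph (2 * n)) n (cell n) = matching_mat n 0 + matching_mat n 1"
    unfolding quotient_mat_cell[OF assms(1)]
    by (intro eq_matI) (simp_all add: matching_mat_def matching_cycle del: One_nat_def add_Suc_right)
  then have B: "shunt_decomposition n (quotient_mat (cycle_digraph (2 * n)) n (cell n))
      (matching_mat n 0) (matching_mat n 1)"
    using assms by (simp add: shunt_decomposition_def matching_mat_permutation)
  have C: "matching_mat n s * matching_mat n s = 1\<^sub>m n" for s
    by (subst matching_mat_mult[of _ n n])
      (use assms in \<open>auto intro!: eq_matI simp: matching_mat_def matching_less matching_matching\<close>)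
  have Q: "Q_vertex n \<in> carrier_mat (2 * n) n"
    by (simp add: Q_vertex_def norm_char_mat_def)
  have D: "matching_mat (2 * n) s * Q_vertex n = Q_vertex n * matching_mat n s" for s
  proof (subst matching_mat_mult[OF Q], rule eq_matI)
    fix u j assume "u < dim_row (Q_vertex n * matching_mat n s)" "j < dim_col (Q_vertex n * matching_mat n s)"
    then have uj: "u < 2 * n" "j < n" using Q by (simp_all add: matching_mat_def)
    let ?c = "complex_of_real (1 / sqrt 2)"
    have "(Q_vertex n * matching_mat n s) $$ (u, j) =
        (\<Sum>v<n. Q_vertex n $$ (u, v) * (if j = matching n s v then 1 else 0))"
      using uj Q by (simp add: matching_mat_def scalar_prod_def atLeast0LessThan)
    also have "\<dots> = (\<Sum>v<n. if v = u mod n then (if j = matching n s v then ?c else 0) else 0)"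
      using uj by (intro sum.cong) (auto simp: Q_entries)
    also have "\<dots> = (if j = matching n s (u mod n) then ?c else 0)"
      using assms by simp
    also have "\<dots> = Q_vertex n $$ (matching (2 * n) s u, j)"
      using assms uj by (auto simp: Q_entries matching_less matching_mod)
    finally show "mat (2 * n) n (\<lambda>(u, j). Q_vertex n $$ (matching (2 * n) s u, j)) $$ (u, j) =
        (Q_vertex n * matching_mat n s) $$ (u, j)"
      using uj by simp
  qed (use Q in \<open>simp_all add: matching_mat_def\<close>)
  show ?thesis using A B C D by blast
qed

end

theory Submission
  imports Defs
begin

text \<open>
  Since \<open>P\<^sub>j Q = Q P'\<^sub>j\<close> and the columns of \<open>Q\<^sub>\<tau>\<close> are orthonormal, \<open>Q\<^sub>\<tau>\<close> intertwines the walk with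
  \<open>W = S' (2 Q Q\<^sup>T - I)\<close> on the \<open>2n\<close> arcs of the quotient graph, where \<open>S'\<close> is built from the
  \<open>P'\<^sub>j\<close>. The reflection exchanges the two arcs into each cell, so \<open>W\<close> maps
  \<open>(e\<^sub>a, e\<^sub>b)\<close> to \<open>(P'\<^sub>1 e\<^sub>b, P'\<^sub>2 e\<^sub>a)\<close>: the two shunts act alternately on either half. Being
  involutions that sum to the adjacency matrix of a cycle, they alternate along it, so one half
  of the state rotates forwards and the other backwards, and the halves starting at cell \<open>i\<close> meet
  again at the antipodal cell after \<open>n/2\<close> steps.
\<close>

section \<open>Matrices\<close>

lemma kronecker_dims [simp]:
  "dim_row (A \<otimes>\<^sub>k B) = dim_row A * dim_row B"
  "dim_col (A \<otimes>\<^sub>k B) = dim_col A * dim_col B"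
  by (simp_all add: kronecker_def)

lemma kronecker_carrier:
  "A \<in> carrier_mat a b \<Longrightarrow> B \<in> carrier_mat c d \<Longrightarrow> A \<otimes>\<^sub>k B \<in> carrier_mat (a * c) (b * d)"
  by auto

lemma index_kronecker:
  "i < dim_row A * dim_row B \<Longrightarrow> j < dim_col A * dim_col B \<Longrightarrow>
    (A \<otimes>\<^sub>k B) $$ (i, j) =
      A $$ (i div dim_row B, j div dim_col B) * B $$ (i mod dim_row B, j mod dim_col B)"
  by (simp add: kronecker_def)

lemma div_mod_less_mult:
  fixes i p q :: nat
  assumes "i < p * q"
  shows "i div q < p" "i mod q < q"
proof -
  have "0 < q" using assms by (cases q) auto
  then show "i div q < p" "i mod q < q"
    using assms by (simp_all add: less_mult_imp_div_less)
qed

text \<open>The range splits into \<open>p\<close> consecutive blocks of length \<open>q\<close>, on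
  each of which \<open>k div q\<close> is constant. This turns the summation index of a product of
  Kronecker products into two independent indices.\<close>

lemma sum_div_mod:
  fixes f :: "nat \<Rightarrow> nat \<Rightarrow> 'a::comm_monoid_add"
  shows "(\<Sum>k<p * q. f (k div q) (k mod q)) = (\<Sum>a<p. \<Sum>b<q. f a b)"
proof -
  have "(\<Sum>k = a * q..<a * q + q. f (k div q) (k mod q)) = (\<Sum>b<q. f a b)" for a
  proof -
    have "(\<Sum>k = a * q..<a * q + q. f (k div q) (k mod q)) =
        (\<Sum>b<q. f ((b + a * q) div q) ((b + a * q) mod q))"
      using sum.shift_bounds_nat_ivl[of "\<lambda>k. f (k div q) (k mod q)" 0 "a * q" q]
      by (simp add: add.commute atLeast0LessThan)
    then show ?thesis by simp
  qed
  then show ?thesis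
    by (simp add: sum.nat_group[symmetric])
qed

text \<open>The mixed-product rule: once the inner index is split into quotient and remainder, the
  double sum factors into two scalar products.\<close>

lemma kronecker_mult:
  assumes "dim_col A = dim_row C" "dim_col B = dim_row D"
  shows "(A \<otimes>\<^sub>k B) * (C \<otimes>\<^sub>k D) = (A * C) \<otimes>\<^sub>k (B * D)"
proof (rule eq_matI)
  fix i j
  assume "i < dim_row ((A * C) \<otimes>\<^sub>k (B * D))" "j < dim_col ((A * C) \<otimes>\<^sub>k (B * D))"
  then have ij: "i < dim_row A * dim_row B" "j < dim_col C * dim_col D" by simp_all
  note b = div_mod_less_mult[OF ij(1)] div_mod_less_mult[OF ij(2)]
  let ?f = "\<lambda>a b. A $$ (i div dim_row B, a) * B $$ (i mod dim_row B, b) *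
    (C $$ (a, j div dim_col D) * D $$ (b, j mod dim_col D))"
  have "((A \<otimes>\<^sub>k B) * (C \<otimes>\<^sub>k D)) $$ (i, j) =
      (\<Sum>k<dim_row C * dim_row D. ?f (k div dim_row D) (k mod dim_row D))"
    using ij assms by (simp add: scalar_prod_def atLeast0LessThan index_kronecker)
  also have "\<dots> = (\<Sum>a<dim_row C. \<Sum>b<dim_row D. ?f a b)"
    by (rule sum_div_mod)
  also have "\<dots> = ((A * C) \<otimes>\<^sub>k (B * D)) $$ (i, j)"
    using ij b assms
    by (simp add: index_kronecker scalar_prod_def atLeast0LessThan sum_product mult_ac)
  finally show "((A \<otimes>\<^sub>k B) * (C \<otimes>\<^sub>k D)) $$ (i, j) = ((A * C) \<otimes>\<^sub>k (B * D)) $$ (i, j)" .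
qed simp_all

lemma transpose_kronecker: "(A \<otimes>\<^sub>k B)\<^sup>T = A\<^sup>T \<otimes>\<^sub>k B\<^sup>T"
  by (rule eq_matI) (auto simp: index_kronecker div_mod_less_mult)

lemma kronecker_one: "1\<^sub>m p \<otimes>\<^sub>k 1\<^sub>m q = 1\<^sub>m (p * q)"
proof (rule eq_matI)
  fix i j assume "i < dim_row (1\<^sub>m (p * q) :: complex mat)" "j < dim_col (1\<^sub>m (p * q) :: complex mat)"
  then have ij: "i < p * q" "j < p * q" by simp_all
  have "i div q = j div q \<and> i mod q = j mod q \<longleftrightarrow> i = j"
    by (metis div_mult_mod_eq)
  then show "(1\<^sub>m p \<otimes>\<^sub>k 1\<^sub>m q) $$ (i, j) = (1\<^sub>m (p * q) :: complex mat) $$ (i, j)"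
    using ij div_mod_less_mult[OF ij(1)] div_mod_less_mult[OF ij(2)]
    by (auto simp: index_kronecker)
qed simp_all

section \<open>Powers, isometries and intertwining\<close>

text \<open>Matrix powers grow by a factor on the right, whereas the newest step of a walk acts on
  the left.\<close>

lemma pow_mat_commute:
  assumes "A \<in> carrier_mat n n"
  shows "A * A ^\<^sub>m k = A ^\<^sub>m k * A"
proof (induction k)
  case (Suc k)
  have "A * (A ^\<^sub>m k * A) = A * A ^\<^sub>m k * A"
    using assms by (intro assoc_mult_mat[symmetric]) auto
  then show ?case using Suc by simp
qed (use assms in simp)

lemma pow_mat_intertwine:
  assumes "U \<in> carrier_mat N N" "W \<in> carrier_mat M M" "Y \<in> carrier_mat N M" "U * Y = Y * W"
  shows "U ^\<^sub>m k * Y = Y * W ^\<^sub>m k"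
proof (induction k)
  case (Suc k)
  have "U ^\<^sub>m k * U * Y = U ^\<^sub>m k * (U * Y)"
    using assms(1-3) by (intro assoc_mult_mat) auto
  also have "\<dots> = U ^\<^sub>m k * Y * W"
    using assms by (subst assms(4)) (intro assoc_mult_mat[symmetric], auto)
  also have "\<dots> = Y * (W ^\<^sub>m k * W)"
    using assms(1-3) by (subst Suc) (intro assoc_mult_mat, auto)
  finally show ?case by simp
qed (use assms in simp)

text \<open>Columns have disjoint supports, so they are orthogonal; column \<open>i\<close> has
  \<open>card (C i)\<close> nonzero entries, each with square \<open>1 / card (C i)\<close>.\<close>

lemma norm_char_mat_isometry:
  assumes "disjoint_family_on C {..<m}" "\<And>i. i < m \<Longrightarrow> C i \<noteq> {}" "\<And>i. i < m \<Longrightarrow> C i \<subseteq> {..<N}"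
  shows "(norm_char_mat N m C)\<^sup>T * norm_char_mat N m C = 1\<^sub>m m"
proof (rule eq_matI)
  fix i j assume "i < dim_row (1\<^sub>m m :: complex mat)" "j < dim_col (1\<^sub>m m :: complex mat)"
  then have ij: "i < m" "j < m" by simp_all
  let ?c = "\<lambda>i. complex_of_real (1 / sqrt (real (card (C i))))"
  have "((norm_char_mat N m C)\<^sup>T * norm_char_mat N m C) $$ (i, j) =
      (\<Sum>v<N. (if v \<in> C i then ?c i else 0) * (if v \<in> C j then ?c j else 0))"
    using ij by (simp add: norm_char_mat_def scalar_prod_def atLeast0LessThan)
  also have "\<dots> = (\<Sum>v \<in> C i \<inter> C j. ?c i * ?c j)"
    using assms(3)[OF ij(1)] by (intro sum.mono_neutral_cong_right) auto
  also have "\<dots> = (if i = j then 1 else 0)"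
  proof (cases "i = j")
    case True
    have "finite (C i)" using assms(3)[OF ij(1)] finite_subset by blast
    then have "0 < card (C i)" using assms(2)[OF ij(1)] by (simp add: card_gt_0_iff)
    moreover have "?c i * ?c i = complex_of_real (1 / real (card (C i)))"
      by (simp only: of_real_mult[symmetric]) simp
    ultimately show ?thesis using True by simp
  next
    case False
    then have "C i \<inter> C j = {}"
      using assms(1) ij by (auto simp: disjoint_family_on_def)
    then show ?thesis using False by simp
  qed
  finally show "((norm_char_mat N m C)\<^sup>T * norm_char_mat N m C) $$ (i, j) = (1\<^sub>m m) $$ (i, j)"
    using ij by simp
qed (simp_all add: norm_char_mat_def)

text \<open>Conjugation passes through a real matrix, so the transpose serves as the adjoint. This
  carries norms from the arcs to the full space.\<close>

lemma real_isometry_inner_prod: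
  fixes Y :: "complex mat"
  assumes Y: "Y \<in> carrier_mat N M" and iso: "Y\<^sup>T * Y = 1\<^sub>m M"
    and real: "\<And>r c. r < N \<Longrightarrow> c < M \<Longrightarrow> Y $$ (r, c) \<in> \<real>"
    and uv: "u \<in> carrier_vec M" "v \<in> carrier_vec M"
  shows "(Y *\<^sub>v u) \<bullet>c (Y *\<^sub>v v) = u \<bullet>c v"
proof -
  have conj: "conjugate (Y *\<^sub>v v) = Y *\<^sub>v conjugate v"
  proof (rule eq_vecI)
    fix r assume "r < dim_vec (Y *\<^sub>v conjugate v)"
    then have r: "r < N" using Y by simp
    have "cnj (Y $$ (r, c)) = Y $$ (r, c)" if "c < M" for c
      using real[OF r that] by (simp add: Reals_cnj_iff)
    then show "conjugate (Y *\<^sub>v v) $ r = (Y *\<^sub>v conjugate v) $ r"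
      using r Y uv by (simp add: scalar_prod_def)
  qed (use Y in simp)
  have "(Y *\<^sub>v u) \<bullet> (Y *\<^sub>v conjugate v) = (Y *\<^sub>v conjugate v) \<bullet> (Y *\<^sub>v u)"
    using Y uv by (intro comm_scalar_prod[of _ N]) auto
  also have "\<dots> = (Y\<^sup>T *\<^sub>v (Y *\<^sub>v conjugate v)) \<bullet> u"
    using Y uv by (intro transpose_vec_mult_scalar[symmetric]) auto
  also have "\<dots> = u \<bullet> (Y\<^sup>T *\<^sub>v (Y *\<^sub>v conjugate v))"
    using Y uv by (intro comm_scalar_prod[of _ M]) auto
  also have "Y\<^sup>T *\<^sub>v (Y *\<^sub>v conjugate v) = (Y\<^sup>T * Y) *\<^sub>v conjugate v"
    using Y uv by (intro assoc_mult_mat_vec[symmetric]) auto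
  finally show ?thesis using uv by (simp add: conj iso)
qed

text \<open>As \<open>Y\<^sup>T * Y\<close> is the identity, \<open>Y * R * Y\<^sup>T\<close> acts
  on the range of \<open>Y\<close> as \<open>R\<close> does on coordinates. The walk is the case
  where \<open>Y\<close> is \<open>Q_tau n\<close> and \<open>R\<close> is the projection
  \<open>Q_arc n * (Q_arc n)\<^sup>T\<close>.\<close>

lemma reflection_intertwine:
  fixes Y :: "complex mat"
  assumes Y: "Y \<in> carrier_mat N M" and R: "R \<in> carrier_mat M M"
    and S: "S \<in> carrier_mat N N" and S': "S' \<in> carrier_mat M M"
    and iso: "Y\<^sup>T * Y = 1\<^sub>m M" and SY: "S * Y = Y * S'"
  shows "S * (2 \<cdot>\<^sub>m (Y * R * Y\<^sup>T) - 1\<^sub>m N) * Y = Y * (S' * (2 \<cdot>\<^sub>m R - 1\<^sub>m M))"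
proof -
  have "Y * R * Y\<^sup>T * Y = Y * R * (Y\<^sup>T * Y)"
    using Y R by (intro assoc_mult_mat) auto
  also have "\<dots> = Y * R" using Y R by (simp add: iso)
  finally have 1: "Y * R * Y\<^sup>T * Y = Y * R" .
  have "(2 \<cdot>\<^sub>m (Y * R * Y\<^sup>T) - 1\<^sub>m N) * Y = 2 \<cdot>\<^sub>m (Y * R * Y\<^sup>T) * Y - 1\<^sub>m N * Y"
    using Y R by (intro minus_mult_distrib_mat) auto
  also have "2 \<cdot>\<^sub>m (Y * R * Y\<^sup>T) * Y = 2 \<cdot>\<^sub>m (Y * R * Y\<^sup>T * Y)"
    using Y R by (intro mult_smult_assoc_mat) auto
  also have "\<dots> = Y * (2 \<cdot>\<^sub>m R)"
    using Y R by (simp only: 1) (intro mult_smult_distrib[symmetric], auto)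
  also have "1\<^sub>m N * Y = Y * 1\<^sub>m M" using Y by simp
  also have "Y * (2 \<cdot>\<^sub>m R) - Y * 1\<^sub>m M = Y * (2 \<cdot>\<^sub>m R - 1\<^sub>m M)"
    using Y R by (intro mult_minus_distrib_mat[symmetric]) auto
  finally have 2: "(2 \<cdot>\<^sub>m (Y * R * Y\<^sup>T) - 1\<^sub>m N) * Y = Y * (2 \<cdot>\<^sub>m R - 1\<^sub>m M)" .
  have "S * (2 \<cdot>\<^sub>m (Y * R * Y\<^sup>T) - 1\<^sub>m N) * Y = S * ((2 \<cdot>\<^sub>m (Y * R * Y\<^sup>T) - 1\<^sub>m N) * Y)"
    using Y R S by (intro assoc_mult_mat) auto
  also have "\<dots> = S * Y * (2 \<cdot>\<^sub>m R - 1\<^sub>m M)"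
    unfolding 2 using Y R S by (intro assoc_mult_mat[symmetric]) auto
  also have "\<dots> = Y * (S' * (2 \<cdot>\<^sub>m R - 1\<^sub>m M))"
    unfolding SY using Y R S' by (intro assoc_mult_mat) auto
  finally show ?thesis .
qed

section \<open>Reduction to the arcs of the quotient graph\<close>

lemma Q_arc_carrier: "Q_arc n \<in> carrier_mat (2 * n) n"
  by (simp add: Q_arc_def norm_char_mat_def)

lemma Q_tau_carrier: "Q_tau n \<in> carrier_mat (4 * n) (2 * n)"
  using kronecker_carrier[OF one_carrier_mat Q_arc_carrier, of 2 n] by (simp add: Q_tau_def)

lemma Q_arc_isometry:
  assumes "2 \<le> n"
  shows "(Q_arc n)\<^sup>T * Q_arc n = 1\<^sub>m n"
  \<comment> \<open>In terms of cells rather than arc sets, the supports are explicit pairs.\<close>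
  unfolding Q_explicit(2) Q_vertex_def
  by (rule norm_char_mat_isometry) (auto simp: cell_def disjoint_family_on_def)

lemma Q_tau_isometry:
  assumes "2 \<le> n"
  shows "(Q_tau n)\<^sup>T * Q_tau n = 1\<^sub>m (2 * n)"
  by (simp add: Q_tau_def transpose_kronecker transpose_one kronecker_mult
      Q_arc_isometry[OF assms] kronecker_one)

lemma Q_tau_Reals:
  assumes "r < 4 * n" "c < 2 * n"
  shows "Q_tau n $$ (r, c) \<in> \<real>"
proof -
  have dims: "dim_row (Q_arc n) = 2 * n" "dim_col (Q_arc n) = n"
    using Q_arc_carrier[of n] by auto
  have r: "r < 2 * (2 * n)" using assms by simp
  note b = div_mod_less_mult[OF r] div_mod_less_mult[OF assms(2)]
  show ?thesis
    using r assms(2) b by (simp add: Q_tau_def index_kronecker dims Q_entries)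
qed

lemma diag_unit_carrier [simp]: "diag_unit m l \<in> carrier_mat m m"
  by (simp add: diag_unit_def)

lemma shunt_operator_carrier:
  assumes "P1 \<in> carrier_mat m m" "P2 \<in> carrier_mat m m"
  shows "shunt_operator P1 P2 \<in> carrier_mat (2 * m) (2 * m)"
  unfolding shunt_operator_def
  by (intro add_carrier_mat kronecker_carrier diag_unit_carrier assms)

text \<open>The diagonal units act on the first tensor factor and commute with the identity there;
  the second factor is the assumed relation for each shunt.\<close>

lemma shunt_operator_intertwine:
  assumes P: "P1 \<in> carrier_mat N N" "P2 \<in> carrier_mat N N"
    and P': "P1' \<in> carrier_mat m m" "P2' \<in> carrier_mat m m"
    and Q: "Q \<in> carrier_mat N m" and PQ: "P1 * Q = Q * P1'" "P2 * Q = Q * P2'"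
  shows "shunt_operator P1 P2 * (1\<^sub>m 2 \<otimes>\<^sub>k Q) = (1\<^sub>m 2 \<otimes>\<^sub>k Q) * shunt_operator P1' P2'"
proof -
  have E: "diag_unit 2 l * 1\<^sub>m 2 = diag_unit 2 l" "1\<^sub>m 2 * diag_unit 2 l = diag_unit 2 l" for l
    by (rule right_mult_one_mat[OF diag_unit_carrier], rule left_mult_one_mat[OF diag_unit_carrier])
  have d: "dim_row (diag_unit 2 l) = 2" "dim_col (diag_unit 2 l) = 2" for l
    by (simp_all add: diag_unit_def)
  have Y: "1\<^sub>m 2 \<otimes>\<^sub>k Q \<in> carrier_mat (2 * N) (2 * m)"
    by (intro kronecker_carrier one_carrier_mat Q)
  note carr = kronecker_carrier[OF diag_unit_carrier P(1)] kronecker_carrier[OF diag_unit_carrier P(2)]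
    kronecker_carrier[OF diag_unit_carrier P'(1)] kronecker_carrier[OF diag_unit_carrier P'(2)]
  have L: "(diag_unit 2 l \<otimes>\<^sub>k P) * (1\<^sub>m 2 \<otimes>\<^sub>k Q) = (1\<^sub>m 2 \<otimes>\<^sub>k Q) * (diag_unit 2 l \<otimes>\<^sub>k P')"
    if "P \<in> carrier_mat N N" "P' \<in> carrier_mat m m" "P * Q = Q * P'" for P P' l
    using that Q by (subst (1 2) kronecker_mult) (auto simp: E d)
  show ?thesis
    unfolding shunt_operator_def
    by (simp only: add_mult_distrib_mat[OF carr(1,2) Y] mult_add_distrib_mat[OF Y carr(3,4)]
        L[OF P(1) P'(1) PQ(1)] L[OF P(2) P'(2) PQ(2)])
qed

lemma transition_operator_carrier:
  assumes "P1 \<in> carrier_mat (2 * n) (2 * n)" "P2 \<in> carrier_mat (2 * n) (2 * n)"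
  shows "transition_operator n P1 P2 \<in> carrier_mat (4 * n) (4 * n)"
  using shunt_operator_carrier[OF assms] Q_tau_carrier[of n]
  by (simp add: transition_operator_def minus_carrier_mat mult_carrier_mat[of _ "4 * n" "4 * n"])

text \<open>The operator \<open>W\<close> of the overview, of half the dimension of the original
  walk.\<close>

definition quotient_walk :: "nat \<Rightarrow> complex mat \<Rightarrow> complex mat \<Rightarrow> complex mat" where
  "quotient_walk n P1 P2 =
     shunt_operator P1 P2 * (2 \<cdot>\<^sub>m (Q_arc n * (Q_arc n)\<^sup>T) - 1\<^sub>m (2 * n))"

lemma quotient_walk_carrier:
  assumes "P1 \<in> carrier_mat n n" "P2 \<in> carrier_mat n n"
  shows "quotient_walk n P1 P2 \<in> carrier_mat (2 * n) (2 * n)"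
  using shunt_operator_carrier[OF assms]
  by (simp add: quotient_walk_def minus_carrier_mat mult_carrier_mat[of _ "2 * n" "2 * n"])

lemma transition_operator_intertwine:
  assumes "2 \<le> n"
    and P: "P1 \<in> carrier_mat (2 * n) (2 * n)" "P2 \<in> carrier_mat (2 * n) (2 * n)"
    and P': "P1' \<in> carrier_mat n n" "P2' \<in> carrier_mat n n"
    and PQ: "P1 * Q_vertex n = Q_vertex n * P1'" "P2 * Q_vertex n = Q_vertex n * P2'"
  shows "transition_operator n P1 P2 * Q_tau n = Q_tau n * quotient_walk n P1' P2'"
  unfolding transition_operator_def quotient_walk_def
proof (rule reflection_intertwine[OF Q_tau_carrier _ _ shunt_operator_carrier[OF P']])
  show "Q_arc n * (Q_arc n)\<^sup>T \<in> carrier_mat (2 * n) (2 * n)"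
    using Q_arc_carrier[of n] by auto
  show "shunt_operator P1 P2 \<in> carrier_mat (4 * n) (4 * n)"
    using shunt_operator_carrier[OF P] by simp
  show "(Q_tau n)\<^sup>T * Q_tau n = 1\<^sub>m (2 * n)"
    by (rule Q_tau_isometry) fact
  show "shunt_operator P1 P2 * Q_tau n = Q_tau n * shunt_operator P1' P2'"
    unfolding Q_tau_def
    by (rule shunt_operator_intertwine[OF P P' Q_arc_carrier]) (simp_all add: PQ Q_explicit(2))
qed

section \<open>The walk on the arcs of the quotient graph\<close>

text \<open>An equal superposition of the arc of the first shunt ending in cell \<open>a\<close> and
  the arc of the second shunt ending in cell \<open>b\<close>; the latter has index
  \<open>n + b\<close>.\<close>

definition arc_state :: "nat \<Rightarrow> nat \<Rightarrow> nat \<Rightarrow> complex vec" where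
  "arc_state n a b = complex_of_real (1 / sqrt 2) \<cdot>\<^sub>v (unit_vec (2 * n) a + unit_vec (2 * n) (n + b))"

lemma arc_state_carrier [simp]: "arc_state n a b \<in> carrier_vec (2 * n)"
  by (simp add: arc_state_def)

lemma x_state_eq:
  assumes "i < n"
  shows "x_state n i = arc_state n i i"
proof (rule eq_vecI)
  fix r assume "r < dim_vec (arc_state n i i)"
  then have r: "r < 2 * n" by (simp add: arc_state_def)
  have "x_state n i $ r = Q_arc n $$ (r, i)"
    using r assms Q_arc_carrier[of n] by (simp add: x_state_def)
  then show "x_state n i $ r = arc_state n i i $ r"
    using r assms by (cases "r < n") (auto simp: Q_entries arc_state_def mod_if)
qed (use Q_arc_carrier[of n] in \<open>simp add: x_state_def arc_state_def\<close>)

lemma arc_state_norm: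
  assumes "2 \<le> n" "i < n"
  shows "arc_state n i i \<bullet>c arc_state n i i = 1"
proof -
  have "x_state n i \<bullet>c x_state n i = unit_vec n i \<bullet>c unit_vec n i"
    unfolding x_state_def
    by (rule real_isometry_inner_prod[OF Q_arc_carrier Q_arc_isometry[OF assms(1)]])
      (simp_all add: Q_entries)
  also have "\<dots> = 1" using assms(2) by simp
  finally show ?thesis by (simp add: x_state_eq[OF assms(2)])
qed

text \<open>Here \<open>a'\<close> and \<open>b'\<close> are full arc indices, without an offset
  \<open>n\<close>, because the reflection moves arcs between the two halves.\<close>

lemma mult_arc_state:
  assumes M: "M \<in> carrier_mat (2 * n) (2 * n)" and ab: "a < n" "b < n"
    and cols: "col M a = unit_vec (2 * n) a'" "col M (n + b) = unit_vec (2 * n) b'"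
  shows "M *\<^sub>v arc_state n a b =
    complex_of_real (1 / sqrt 2) \<cdot>\<^sub>v (unit_vec (2 * n) a' + unit_vec (2 * n) b')"
proof -
  have u: "M *\<^sub>v unit_vec (2 * n) c = col M c" if "c < 2 * n" for c
    using M that by (intro eq_vecI) auto
  show ?thesis
    unfolding arc_state_def
    using M ab by (simp add: mult_mat_vec[OF M] mult_add_distrib_mat_vec[OF M] u cols)
qed

text \<open>Entries of \<open>2 \<cdot>\<^sub>m (Q_arc n * (Q_arc n)\<^sup>T)\<close> are 1 where
  the indices agree modulo \<open>n\<close> and 0 elsewhere. Subtracting the identity leaves the
  swap of \<open>t\<close> and \<open>n + t\<close>.\<close>

lemma grover_arc_state:
  assumes "a < n" "b < n"
  shows "(2 \<cdot>\<^sub>m (Q_arc n * (Q_arc n)\<^sup>T) - 1\<^sub>m (2 * n)) *\<^sub>v arc_state n a b = arc_state n b a"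
    (is "?M *\<^sub>v _ = _")
proof -
  have dims: "dim_row (Q_arc n) = 2 * n" "dim_col (Q_arc n) = n"
    using Q_arc_carrier[of n] by auto
  have s: "complex_of_real (1 / sqrt 2) * complex_of_real (1 / sqrt 2) = 1 / 2"
    by (simp only: of_real_mult[symmetric]) simp
  have R: "row (Q_arc n) r \<bullet> row (Q_arc n) c = (if r mod n = c mod n then 1 / 2 else 0)"
    if "r < 2 * n" "c < 2 * n" for r c
  proof -
    have "row (Q_arc n) r \<bullet> row (Q_arc n) c = (\<Sum>t<n. Q_arc n $$ (r, t) * Q_arc n $$ (c, t))"
      using that by (simp add: scalar_prod_def atLeast0LessThan dims)
    also have "\<dots> = (\<Sum>t<n. if t = r mod n then (if r mod n = c mod n then 1 / 2 else 0) else 0)"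
      using that by (intro sum.cong) (auto simp: Q_entries s simp del: of_real_divide)
    also have "\<dots> = (if r mod n = c mod n then 1 / 2 else 0)"
      using assms by simp
    finally show ?thesis .
  qed
  have M: "?M \<in> carrier_mat (2 * n) (2 * n)" by (simp add: minus_carrier_mat)
  have "col ?M a = unit_vec (2 * n) (n + a)"
  proof (rule eq_vecI)
    fix r assume "r < dim_vec (unit_vec (2 * n) (n + a) :: complex vec)"
    then show "col ?M a $ r = unit_vec (2 * n) (n + a) $ r"
      using assms by (cases "r < n") (auto simp: dims R mod_if)
  qed simp
  moreover have "col ?M (n + b) = unit_vec (2 * n) b"
  proof (rule eq_vecI)
    fix r assume "r < dim_vec (unit_vec (2 * n) b :: complex vec)"
    then show "col ?M (n + b) $ r = unit_vec (2 * n) b $ r"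
      using assms by (cases "r < n") (auto simp: dims R mod_if)
  qed simp
  ultimately show ?thesis
    using mult_arc_state[OF M assms]
    by (simp add: arc_state_def comm_add_vec[of "unit_vec (2 * n) b" "2 * n"])
qed

abbreviation perm_mat :: "nat \<Rightarrow> (nat \<Rightarrow> nat) \<Rightarrow> complex mat" where
  "perm_mat n f \<equiv> mat n n (\<lambda>(u, v). if v = f u then 1 else 0)"

text \<open>Read off from the diagonal entry \<open>(u, u)\<close> of the square.\<close>

lemma perm_mat_involution:
  assumes "f permutes {..<n}" "perm_mat n f * perm_mat n f = 1\<^sub>m n" "u < n"
  shows "f (f u) = u"
proof -
  have lt: "f u < n" using permutes_in_image[OF assms(1), of u] assms(3) by simp
  have "(perm_mat n f * perm_mat n f) $$ (u, u) =
      (\<Sum>v<n. (if v = f u then 1 else 0) * (if u = f v then 1 else 0))"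
    using assms(3) by (simp add: scalar_prod_def atLeast0LessThan)
  also have "\<dots> = (\<Sum>v<n. if v = f u then (if u = f v then 1 else 0) else 0)"
    by (rule sum.cong) auto
  also have "\<dots> = (if u = f (f u) then 1 else 0)"
    using lt by simp
  finally show ?thesis
    using assms(2,3) by (simp split: if_splits)
qed

text \<open>Column \<open>a\<close> of \<open>perm_mat n f\<close> has its one in the row that
  \<open>f\<close> sends to \<open>a\<close>; for an involution this row is
  \<open>f a\<close>.\<close>

lemma shunt_arc_state:
  assumes f: "f permutes {..<n}" "\<And>u. u < n \<Longrightarrow> f (f u) = u"
    and g: "g permutes {..<n}" "\<And>u. u < n \<Longrightarrow> g (g u) = u"
    and ab: "a < n" "b < n"
  shows "shunt_operator (perm_mat n f) (perm_mat n g) *\<^sub>v arc_state n a b = arc_state n (f a) (g b)"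
    (is "?S *\<^sub>v _ = _")
proof -
  have S: "?S \<in> carrier_mat (2 * n) (2 * n)"
    by (rule shunt_operator_carrier) simp_all
  have fg: "f u < n" "g u < n" if "u < n" for u
    using that permutes_in_image[OF f(1), of u] permutes_in_image[OF g(1), of u] by simp_all
  have inv: "a = f u \<longleftrightarrow> u = f a" "b = g u \<longleftrightarrow> u = g b" if "u < n" for u
    using that f(2) g(2) ab by metis+
  have dv: "r div n = (if r < n then 0 else 1)" "r mod n = (if r < n then r else r - n)"
    if "r < 2 * n" for r
    using that by (auto simp: mod_if div_nat_eqI)
  have "col ?S a = unit_vec (2 * n) (f a)"
  proof (rule eq_vecI)
    fix r assume "r < dim_vec (unit_vec (2 * n) (f a) :: complex vec)"
    then have r: "r < 2 * n" by simp
    show "col ?S a $ r = unit_vec (2 * n) (f a) $ r"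
      using r ab S fg[OF ab(1)]
      by (auto simp: shunt_operator_def index_kronecker diag_unit_def dv inv)
  qed (use S in simp)
  moreover have "col ?S (n + b) = unit_vec (2 * n) (n + g b)"
  proof (rule eq_vecI)
    fix r assume "r < dim_vec (unit_vec (2 * n) (n + g b) :: complex vec)"
    then have r: "r < 2 * n" by simp
    show "col ?S (n + b) $ r = unit_vec (2 * n) (n + g b) $ r"
      using r ab S fg[OF ab(2)]
      by (auto simp: shunt_operator_def index_kronecker diag_unit_def dv inv)
  qed (use S in simp)
  ultimately show ?thesis
    using mult_arc_state[OF S ab] by (simp add: arc_state_def)
qed

lemma quotient_walk_arc_state:
  assumes f: "f permutes {..<n}" "\<And>u. u < n \<Longrightarrow> f (f u) = u"
    and g: "g permutes {..<n}" "\<And>u. u < n \<Longrightarrow> g (g u) = u"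
    and ab: "a < n" "b < n"
  shows "quotient_walk n (perm_mat n f) (perm_mat n g) *\<^sub>v arc_state n a b = arc_state n (f b) (g a)"
proof -
  have S: "shunt_operator (perm_mat n f) (perm_mat n g) \<in> carrier_mat (2 * n) (2 * n)"
    by (rule shunt_operator_carrier) simp_all
  show ?thesis
    unfolding quotient_walk_def
    by (subst assoc_mult_mat_vec[OF S, of _ "2 * n"])
      (simp_all add: minus_carrier_mat grover_arc_state[OF ab] shunt_arc_state[OF f g ab(2,1)])
qed

section \<open>Alternation of the shunts along the cycle\<close>

text \<open>A sum of two indicators determines its pair of points with multiplicity. Coinciding
  points are allowed, as occurs for the doubled arcs when \<open>n = 2\<close>.\<close>

lemma indicator_sum_eq_cases:
  assumes "\<And>v. v \<in> {x, p, q} \<Longrightarrow> (if v = x then 1 else 0) + (if v = y then 1 else 0) =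
      (if v = p then 1 else 0) + (if v = q then 1 else (0::complex))"
  shows "x = p \<and> y = q \<or> x = q \<and> y = p"
  using assms[of x] assms[of p] assms[of q] by (auto split: if_splits)

text \<open>Row \<open>u\<close> of the quotient matrix marks the successor and predecessor of
  \<open>u\<close>, so the two shunts take one each. The sign \<open>e\<close> records the direction
  of \<open>f\<close> at \<open>u\<close> and may vary with \<open>u\<close>.\<close>

lemma cycle_shunts:
  assumes "2 \<le> n" "f permutes {..<n}" "g permutes {..<n}"
    and quot: "quotient_mat (cycle_digraph (2 * n)) n (cell n) = perm_mat n f + perm_mat n g"
    and u: "u < n"
  shows "\<exists>e::int. (e = 1 \<or> e = -1) \<and> [int (f u) = int u + e] (mod int n) \<and>
    [int (g u) = int u - e] (mod int n)"
proof -
  define p where "p = (u + 1) mod n"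
  \<comment> \<open>The predecessor of \<open>u\<close>; adding \<open>n - 1\<close> avoids
    truncated subtraction at \<open>u = 0\<close>.\<close>
  define q where "q = (u + (n - 1)) mod n"
  have lt: "f u < n" "g u < n" "p < n" "q < n"
    using u permutes_in_image[OF assms(2), of u] permutes_in_image[OF assms(3), of u] assms(1)
    by (simp_all add: p_def q_def)
  have q: "u = (v + 1) mod n \<longleftrightarrow> v = q" if "v < n" for v
  proof
    assume "u = (v + 1) mod n"
    then have "q = (v + 1 + (n - 1)) mod n" by (simp only: q_def mod_add_left_eq)
    then show "v = q" using that by simp
  next
    assume "v = q"
    then have "(v + 1) mod n = (u + (n - 1) + 1) mod n" by (simp only: q_def mod_add_left_eq)
    then show "u = (v + 1) mod n" using u assms(1) by simp
  qed
  have eq: "(if v = f u then 1 else 0) + (if v = g u then 1 else 0) =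
      (if v = p then 1 else 0) + (if v = q then 1 else (0::complex))" if "v < n" for v
  proof -
    have "(perm_mat n f + perm_mat n g) $$ (u, v) =
        (if v = (u + 1) mod n then 1 else 0) + (if u = (v + 1) mod n then 1 else 0)"
      unfolding quot[symmetric] quotient_mat_cell[OF assms(1)] using u that by simp
    then show ?thesis using u that by (simp only: q[OF that] p_def) simp
  qed
  have "f u = p \<and> g u = q \<or> f u = q \<and> g u = p"
    by (rule indicator_sum_eq_cases) (use eq lt in blast)
  moreover have "[int p = int u + 1] (mod int n)"
    by (simp add: p_def cong_def zmod_int add.commute)
  moreover have "[int q = int u - 1] (mod int n)"
  proof -
    have "[int q = int u + (int n - 1)] (mod int n)"
      using assms(1) by (simp add: q_def cong_def zmod_int of_nat_diff add_diff_eq)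
    also have "[int u + (int n - 1) = int u - 1] (mod int n)"
      by (simp add: cong_iff_dvd_diff)
    finally show ?thesis .
  qed
  ultimately show ?thesis
    by (elim disjE) (rule exI[of _ 1], simp, rule exI[of _ "-1"], simp)
qed

text \<open>If one shunt leads from \<open>x\<close> back to \<open>b\<close>, the other continues
  in the direction of arrival. Only \<open>d\<close> and \<open>e\<close> modulo \<open>m\<close>
  are compared: for \<open>m = 2\<close> the signs 1 and -1 are congruent.\<close>

lemma cong_offset_unique:
  fixes x y b d e m :: int
  assumes "[b = x + d] (mod m)" "[x = b - e] (mod m)" "[y = x - d] (mod m)"
  shows "[y = x - e] (mod m)"
proof -
  have "y - (x - e) = (b - (x + d)) + (x - (b - e)) + (y - (x - d))" by simp
  then show ?thesis
    using assms unfolding cong_iff_dvd_diff by (metis dvd_add)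
qed

text \<open>The last two congruences strengthen the induction: they fix the direction of the next
  step of each half. The step exchanges the halves, so \<open>e\<close> changes sign each time while
  each moving part keeps its direction.\<close>

lemma quotient_walk_power:
  assumes n: "2 \<le> n" and f: "f permutes {..<n}" "\<And>u. u < n \<Longrightarrow> f (f u) = u"
    and g: "g permutes {..<n}" "\<And>u. u < n \<Longrightarrow> g (g u) = u"
    and quot: "quotient_mat (cycle_digraph (2 * n)) n (cell n) = perm_mat n f + perm_mat n g"
    and i: "i < n"
  shows "\<exists>a b. \<exists>e::int. a < n \<and> b < n \<and> (e = 1 \<or> e = -1) \<and>
    (quotient_walk n (perm_mat n f) (perm_mat n g) ^\<^sub>m m) *\<^sub>v arc_state n i i = arc_state n a b \<and>
    [int a = int i + e * int m] (mod int n) \<and> [int b = int i - e * int m] (mod int n) \<and>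
    [int (g a) = int a + e] (mod int n) \<and> [int (f b) = int b - e] (mod int n)"
proof (induction m)
  case 0
  obtain e :: int where "e = 1 \<or> e = -1" "[int (f i) = int i + e] (mod int n)"
    "[int (g i) = int i - e] (mod int n)"
    using cycle_shunts[OF n f(1) g(1) quot i] by blast
  \<comment> \<open>The first component moves next by \<open>g\<close>, which shifts
    \<open>i\<close> by \<open>-e\<close>; hence the witness \<open>-e\<close>.\<close>
  then show ?case
    using i quotient_walk_carrier[of "perm_mat n f" n "perm_mat n g"]
    by (intro exI[of _ i] exI[of _ "-e"]) auto
next
  case (Suc m)
  let ?W = "quotient_walk n (perm_mat n f) (perm_mat n g)"
  have W: "?W \<in> carrier_mat (2 * n) (2 * n)"
    by (rule quotient_walk_carrier) simp_all
  from Suc obtain a b and e :: int where ab: "a < n" "b < n" and e: "e = 1 \<or> e = -1"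
    and st: "(?W ^\<^sub>m m) *\<^sub>v arc_state n i i = arc_state n a b"
    and a: "[int a = int i + e * int m] (mod int n)" and b: "[int b = int i - e * int m] (mod int n)"
    and ga: "[int (g a) = int a + e] (mod int n)" and fb: "[int (f b) = int b - e] (mod int n)"
    by blast
  have lt: "f b < n" "g a < n"
    using ab permutes_in_image[OF f(1), of b] permutes_in_image[OF g(1), of a] by simp_all
  have "(?W ^\<^sub>m Suc m) *\<^sub>v arc_state n i i = (?W * ?W ^\<^sub>m m) *\<^sub>v arc_state n i i"
    by (simp add: pow_mat_commute[OF W])
  also have "\<dots> = ?W *\<^sub>v arc_state n a b"
    using W by (subst assoc_mult_mat_vec[of _ "2 * n" "2 * n" _ "2 * n"]) (auto simp: st)
  also have "\<dots> = arc_state n (f b) (g a)"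
    by (rule quotient_walk_arc_state[OF f g ab])
  finally have st': "(?W ^\<^sub>m Suc m) *\<^sub>v arc_state n i i = arc_state n (f b) (g a)" .
  have fb': "[int (f b) = int i + - e * int (Suc m)] (mod int n)"
    using cong_trans[OF fb cong_diff[OF b cong_refl[of e]]] by (simp add: algebra_simps)
  have ga': "[int (g a) = int i - - e * int (Suc m)] (mod int n)"
    using cong_trans[OF ga cong_add[OF a cong_refl[of e]]] by (simp add: algebra_simps)
  \<comment> \<open>At \<open>f b\<close> the involution \<open>f\<close> leads back to
    \<open>b\<close>, so \<open>g\<close> must lead onward.\<close>
  obtain d :: int where d: "d = 1 \<or> d = -1" "[int (f (f b)) = int (f b) + d] (mod int n)"
    "[int (g (f b)) = int (f b) - d] (mod int n)"
    using cycle_shunts[OF n f(1) g(1) quot lt(1)] by blast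
  have gfb: "[int (g (f b)) = int (f b) + - e] (mod int n)"
    using cong_offset_unique[of "int b" "int (f b)" d "int n" e] d(2,3) fb f(2)[OF ab(2)] by simp
  obtain c :: int where c: "c = 1 \<or> c = -1" "[int (f (g a)) = int (g a) + c] (mod int n)"
    "[int (g (g a)) = int (g a) - c] (mod int n)"
    using cycle_shunts[OF n f(1) g(1) quot lt(2)] by blast
  \<comment> \<open>The mirror case, with \<open>g\<close> leading back; the sign in
    \<open>cycle_shunts\<close> is that of \<open>f\<close>, hence the negated offsets.\<close>
  have fga: "[int (f (g a)) = int (g a) - - e] (mod int n)"
    using cong_offset_unique[of "int a" "int (g a)" "-c" "int n" "-e"] c(2,3) ga g(2)[OF ab(1)] by simp
  show ?case
    using lt e st' fb' ga' gfb fga by (intro exI[of _ "f b"] exI[of _ "g a"] exI[of _ "- e"]) auto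
qed

section \<open>Perfect state transfer to the antipodal cell\<close>

theorem theorem7p7:
  fixes n i j :: nat and P1 P2 P1' P2' :: "complex mat"
  assumes "2 \<le> n" and "even n"
    and "shunt_decomposition (2 * n) (adjacency_mat (2 * n) (cycle_digraph (2 * n))) P1 P2"
    and "shunt_decomposition n (quotient_mat (cycle_digraph (2 * n)) n (cell n)) P1' P2'"
    and "P1 * Q_vertex n = Q_vertex n * P1'"
    and "P2 * Q_vertex n = Q_vertex n * P2'"
    and "P1' * P1' = 1\<^sub>m n"
    and "P2' * P2' = 1\<^sub>m n"
    and "i < n" and "j < n" and "[j = i + n div 2] (mod n)"
  shows "perfect_state_transfer (transition_operator n P1 P2) (n div 2)
           (Q_tau n *\<^sub>v x_state n i) (Q_tau n *\<^sub>v x_state n j)"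
proof -
  let ?U = "transition_operator n P1 P2" and ?W = "quotient_walk n P1' P2'" and ?k = "n div 2"
  obtain f g where f: "f permutes {..<n}" "P1' = perm_mat n f"
    and g: "g permutes {..<n}" "P2' = perm_mat n g"
    and quot: "quotient_mat (cycle_digraph (2 * n)) n (cell n) = perm_mat n f + perm_mat n g"
    using assms(4) by (auto simp: shunt_decomposition_def permutation_matrix_def)
  have ff: "f (f u) = u" and gg: "g (g u) = u" if "u < n" for u
    using that perm_mat_involution f g assms(7,8) by blast+
  have P: "P1 \<in> carrier_mat (2 * n) (2 * n)" "P2 \<in> carrier_mat (2 * n) (2 * n)"
    using assms(3) by (auto simp: shunt_decomposition_def permutation_matrix_def)
  have P': "P1' \<in> carrier_mat n n" "P2' \<in> carrier_mat n n"
    using f g by simp_all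
  note U = transition_operator_carrier[OF P] and W = quotient_walk_carrier[OF P']
    and Y = Q_tau_carrier[of n]
  have "\<exists>a b. \<exists>e::int. a < n \<and> b < n \<and> (e = 1 \<or> e = -1) \<and>
      (?W ^\<^sub>m ?k) *\<^sub>v arc_state n i i = arc_state n a b \<and>
      [int a = int i + e * int ?k] (mod int n) \<and> [int b = int i - e * int ?k] (mod int n)"
    unfolding f g using quotient_walk_power[OF assms(1) f(1) ff g(1) gg quot assms(9)] by blast
  then obtain a b and e :: int where ab: "a < n" "b < n" and e: "e = 1 \<or> e = -1"
    and st: "(?W ^\<^sub>m ?k) *\<^sub>v arc_state n i i = arc_state n a b"
    and a: "[int a = int i + e * int ?k] (mod int n)" and b: "[int b = int i - e * int ?k] (mod int n)"
    by blast
  \<comment> \<open>The difference is twice \<open>n div 2\<close>, which equals \<open>n\<close>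
    because \<open>n\<close> is even: both halves of the state meet, whichever sign \<open>e\<close>
    has.\<close>
  have "int n dvd int i + int ?k - (int i - int ?k)"
    using assms(2) by auto
  then have half: "[int i - int ?k = int i + int ?k] (mod int n)"
    by (simp add: cong_iff_dvd_diff dvd_diff_commute)
  have j: "[int i + int ?k = int j] (mod int n)"
    using assms(11) by (metis cong_int_iff cong_sym of_nat_add)
  have "[int a = int j] (mod int n)" "[int b = int j] (mod int n)"
    using e a b cong_trans[OF half j] j by (auto intro: cong_trans)
  then have "a = j" "b = j"
    using ab assms(10) by (simp_all add: cong_int_iff cong_less_modulus_unique_nat)
  then have Wk: "(?W ^\<^sub>m ?k) *\<^sub>v arc_state n i i = arc_state n j j"
    using st by simp
  \<comment> \<open>The evolution on arcs is lifted back to the full space.\<close>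
  have "?U ^\<^sub>m ?k * Q_tau n = Q_tau n * ?W ^\<^sub>m ?k"
    using pow_mat_intertwine[OF U W Y transition_operator_intertwine[OF assms(1) P P' assms(5,6)]] .
  then have "(?U ^\<^sub>m ?k) *\<^sub>v (Q_tau n *\<^sub>v arc_state n i i) = (Q_tau n * ?W ^\<^sub>m ?k) *\<^sub>v arc_state n i i"
    using U Y by (subst assoc_mult_mat_vec[symmetric, of _ "4 * n" "4 * n" _ "2 * n"]) auto
  also have "\<dots> = Q_tau n *\<^sub>v arc_state n j j"
    using W Y by (subst assoc_mult_mat_vec[of _ "4 * n" "2 * n" _ "2 * n"]) (auto simp: Wk)
  finally have Uk: "(?U ^\<^sub>m ?k) *\<^sub>v (Q_tau n *\<^sub>v arc_state n i i) = Q_tau n *\<^sub>v arc_state n j j" .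
  have norm: "(Q_tau n *\<^sub>v arc_state n l l) \<bullet>c (Q_tau n *\<^sub>v arc_state n l l) = 1" if "l < n" for l
    by (simp add: real_isometry_inner_prod[OF Y Q_tau_isometry[OF assms(1)] Q_tau_Reals]
        arc_state_norm[OF assms(1) that])
  \<comment> \<open>The walk reaches the target state exactly, with phase 1, so the overlap is the
    squared norm of the target.\<close>
  show ?thesis
    using U Y assms(9,10) by (simp add: perfect_state_transfer_def x_state_eq Uk norm)
qed

end
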